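(* Let $n\ge 1$, let $\widetilde{G}:Sp(2n,\mathbb{R})\to\mathbb{R}$ be a smooth function and let $G:\mathcal{M}_{2n}(\mathbb{R})\to\mathbb{R}$ be a smooth function with $G|_{Sp(2n,\mathbb{R})}=\widetilde{G}$. A matrix $M\in Sp(2n,\mathbb{R})$ is a critical point of $\widetilde{G}$ if and only if $$JM^T\nabla_{Euc} G(M)=\nabla_{Euc} G(M)^TMJ.$$ Moreover, if $M$ is a critical point of $\widetilde{G}$, then the matrix of Lagrange multipliers $\widetilde{\Sigma}(M)$ (defined in the context) has the explicit form $$\widetilde{\Sigma}(M)=JM^T\nabla_{Euc} G(M).$$
   Context: $\mathcal{M}_{2n}(\mathbb{R})$ is the space of real $2n\times 2n$ matrices with the Euclidean (Frobenius) inner product $\langle X,Y\rangle_{Euc}=\mathrm{tr}(X^TY)$; $\nabla_{Euc}$ is the gradient with respect to it. $J=\begin{bmatrix}0&\mathbb{I}_n\\-\mathbb{I}_n&0\end{bmatrix}$ and $Sp(2n,\mathbb{R})=\{M\in\mathcal{M}_{2n}(\mathbb{R}) : M^TJM=J\}$, an embedded submanifold of $\mathcal{M}_{2n}(\mathbb{R})$. Constraint functions. Write $M=\begin{bmatrix}A&B\\C&D\end{bmatrix}$ with $n\times n$ blocks having columns $a_i,b_i,c_i,d_i\in\mathbb{R}^n$ respectively. Put $F^{AC}_{ij}(M)=\langle a_i,c_j\rangle-\langle a_j,c_i\rangle$ and $F^{BD}_{ij}(M)=\langle b_i,d_j\rangle-\langle b_j,d_i\rangle$ for $1\le i<j\le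 n$, and $F_{ij}(M)=\langle a_i,d_j\rangle-\langle c_i,b_j\rangle-\delta_{ij}$ for $1\le i,j\le n$. These $2n^2-n$ functions are functionally independent and their common zero set is $Sp(2n,\mathbb{R})$. Lagrange multipliers. Enumerate the constraint functions as $F_1,\dots,F_k$, $k=2n^2-n$. The Lagrange multiplier function attached to $F_i$ is $$\sigma^i=\frac{\det\big[\langle\nabla_{Euc}H^{(i)}_q,\nabla_{Euc}F_p\rangle_{Euc}\big]_{p,q=1}^k}{\det\big[\langle\nabla_{Euc}F_q,\nabla_{Euc}F_p\rangle_{Euc}\big]_{p,q=1}^k},$$ where $H^{(i)}_q=F_q$ for $q\ne i$ and $H^{(i)}_i=G$. (Equivalently, at $M\in Sp(2n,\mathbb{R})$ the $\sigma^i(M)$ are the unique coefficients such that $\nabla_{Euc}G(M)-\sum_i\sigma^i(M)\nabla_{Euc}F_i(M)$ is orthogonal to every $\nabla_{Euc}F_p(M)$.) Denote the multipliers of $F^{AC}_{ij},F^{BD}_{ij},F_{ij}$ by $\sigma^{ij}_{AC},\sigma^{ij}_{BD},\sigma^{ij}$. Let $\Sigma_{AC}$, $\Sigma_{BD}$ be the $n\times n$ skew-symmetric matrices whose $(i,j)$ entries for $i<j$ are $\sigma^{ij}_{AC}$, $\sigma^{ij}_{BD}$, let $\Sigma=[\sigma^{ij}]_{i,j=1}^n$, and let $\widetilde{\Sigma}(M)=\begin{bmatrix}\Sigma_{AC}(M)&\Sigma(M)\\-\Sigma(M)^T&\Sigma_{BD}(M)\end{bmatrix}$, a $2n\times 2n$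 skew-symmetric matrix. *)

theory Defs
  imports "HOL-Analysis.Analysis"
begin

section \<open>Smooth functions and critical points\<close>

text \<open>Meant for open \<open>U\<close>.  In finite dimension, a map is \<open>C\<^sup>k\<^sup>+\<^sup>1\<close> iff it is differentiable and
  all its directional derivatives are \<open>C\<^sup>k\<close>.\<close>

primrec Ck_on :: "nat \<Rightarrow> 'a::euclidean_space set \<Rightarrow> ('a \<Rightarrow> 'b::real_normed_vector) \<Rightarrow> bool" where
  "Ck_on 0 U f \<longleftrightarrow> continuous_on U f"
| "Ck_on (Suc k) U f \<longleftrightarrow>
     (\<forall>x\<in>U. f differentiable (at x)) \<and>
     (\<forall>v. Ck_on k U (\<lambda>x. frechet_derivative f (at x) v))"

definition smooth_on :: "'a::euclidean_space set \<Rightarrow> ('a \<Rightarrow> 'b::real_normed_vector) \<Rightarrow> bool" where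
  "smooth_on U f \<longleftrightarrow> (\<forall>k. Ck_on k U f)"

text \<open>Smoothness of a real function on an embedded submanifold \<open>S\<close> of Euclidean space: locally it is
  the restriction of a smooth function of the ambient space.  Values off \<open>S\<close> are irrelevant.\<close>

definition smooth_on_submanifold :: "'a::euclidean_space set \<Rightarrow> ('a \<Rightarrow> real) \<Rightarrow> bool" where
  "smooth_on_submanifold S f \<longleftrightarrow>
     (\<forall>p\<in>S. \<exists>U g. open U \<and> p \<in> U \<and> smooth_on U g \<and> (\<forall>x\<in>S \<inter> U. g x = f x))"

text \<open>The differential of \<open>f\<close> on the embedded submanifold \<open>S\<close> vanishes at \<open>p\<close>.  Tangent vectors are
  the velocities at \<open>0\<close> of smooth curves in \<open>S\<close> through \<open>p\<close>, and the differential of \<open>f\<close> sends the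
  velocity of \<open>\<gamma>\<close> to the derivative of \<open>f \<circ> \<gamma>\<close>.  Only values of \<open>f\<close> on \<open>S\<close> matter.\<close>

definition critical_point_on :: "'a::euclidean_space set \<Rightarrow> ('a \<Rightarrow> real) \<Rightarrow> 'a \<Rightarrow> bool" where
  "critical_point_on S f p \<longleftrightarrow>
     p \<in> S \<and>
     (\<forall>(\<gamma>::real \<Rightarrow> 'a) e. e > 0 \<and> smooth_on {-e<..<e} \<gamma> \<and> \<gamma> ` {-e<..<e} \<subseteq> S \<and> \<gamma> 0 = p
        \<longrightarrow> ((f \<circ> \<gamma>) has_real_derivative 0) (at 0))"

text \<open>On matrices the library's inner product is the Frobenius one, so \<open>grad\<close> below is
  the gradient with respect to it.\<close>

lemma inner_matrix_eq_trace:
  fixes X Y :: "real^'m::finite^'k::finite"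
  shows "X \<bullet> Y = trace (transpose X ** Y)"
  unfolding inner_vec_def trace_def matrix_matrix_mult_def transpose_def
  by simp (rule sum.swap)

definition grad :: "('a::real_inner \<Rightarrow> real) \<Rightarrow> 'a \<Rightarrow> 'a" where
  "grad f x = (THE D. GDERIV f x :> D)"


section \<open>The symplectic group\<close>

text \<open>The index type \<open>'n\<close> ranges over finite linear orders, i.e. over \<open>{1..n}\<close> with \<open>n \<ge> 1\<close> up to order
  isomorphism; \<open>'n + 'n\<close> indexes the rows and columns of \<open>2n \<times> 2n\<close> matrices.\<close>

type_synonym 'n sqmat = "real^'n^'n"

type_synonym 'n mat2 = "('n + 'n) sqmat"

definition block :: "('n::finite) sqmat \<Rightarrow> 'n sqmat \<Rightarrow> 'n sqmat \<Rightarrow> 'n sqmat \<Rightarrow> 'n mat2" where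
  "block A B C D = (\<chi> r c.
     (case r of
        Inl i \<Rightarrow> (case c of Inl j \<Rightarrow> A $ i $ j | Inr j \<Rightarrow> B $ i $ j)
      | Inr i \<Rightarrow> (case c of Inl j \<Rightarrow> C $ i $ j | Inr j \<Rightarrow> D $ i $ j)))"

definition J :: "('n::finite) mat2" where
  "J = block 0 (mat 1) (- mat 1) 0"

definition Sp :: "('n::finite) mat2 set" where
  "Sp = {M. transpose M ** J ** M = J}"

definition colA :: "('n::finite) mat2 \<Rightarrow> 'n \<Rightarrow> real^'n" where
  "colA M i = (\<chi> r. M $ Inl r $ Inl i)"

definition colB :: "('n::finite) mat2 \<Rightarrow> 'n \<Rightarrow> real^'n" where
  "colB M i = (\<chi> r. M $ Inl r $ Inr i)"

definition colC :: "('n::finite) mat2 \<Rightarrow> 'n \<Rightarrow> real^'n" where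
  "colC M i = (\<chi> r. M $ Inr r $ Inl i)"

definition colD :: "('n::finite) mat2 \<Rightarrow> 'n \<Rightarrow> real^'n" where
  "colD M i = (\<chi> r. M $ Inr r $ Inr i)"


section \<open>Constraint functions and Lagrange multipliers\<close>

text \<open>\<open>AC i j\<close>, \<open>BD i j\<close>, \<open>AD i j\<close> name \<open>F\<^sup>A\<^sup>C\<^sub>i\<^sub>j\<close>, \<open>F\<^sup>B\<^sup>D\<^sub>i\<^sub>j\<close>, \<open>F\<^sub>i\<^sub>j\<close>; the first two are
  admitted only for \<open>i < j\<close>.  The type \<open>'n cidx\<close> has \<open>2n\<^sup>2 - n\<close> elements and replaces the
  enumeration \<open>1, \<dots>, k\<close>; determinants do not depend on the choice of an enumeration.\<close>

datatype 'n label = AC 'n 'n | BD 'n 'n | AD 'n 'n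

definition labels :: "('n::{finite,linorder}) label set" where
  "labels = {AC i j | i j. i < j} \<union> {BD i j | i j. i < j} \<union> {AD i j | i j. True}"

typedef (overloaded) 'n cidx = "labels :: ('n::{finite,linorder}) label set"
  by (rule exI[of _ "AD undefined undefined"]) (simp add: labels_def)

lemma finite_labels: "finite (labels :: ('n::{finite,linorder}) label set)"
proof -
  have "labels \<subseteq> case_prod AC ` (UNIV :: ('n \<times> 'n) set) \<union> case_prod BD ` UNIV \<union> case_prod AD ` UNIV"
    unfolding labels_def by auto
  then show ?thesis
    by (rule finite_subset) simp
qed

instance cidx :: ("{finite,linorder}") finite
proof
  show "finite (UNIV :: 'a cidx set)"
    using type_definition.univ[OF type_definition_cidx] finite_labels by (metis finite_imageI)
qed

fun constraint_fun :: "('n::{finite,linorder}) label \<Rightarrow> 'n mat2 \<Rightarrow> real" where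
  "constraint_fun (AC i j) M = colA M i \<bullet> colC M j - colA M j \<bullet> colC M i"
| "constraint_fun (BD i j) M = colB M i \<bullet> colD M j - colB M j \<bullet> colD M i"
| "constraint_fun (AD i j) M =
     colA M i \<bullet> colD M j - colC M i \<bullet> colB M j - (if i = j then 1 else 0)"

definition F :: "('n::{finite,linorder}) cidx \<Rightarrow> 'n mat2 \<Rightarrow> real" where
  "F c = constraint_fun (Rep_cidx c)"

definition multiplier :: "(('n::{finite,linorder}) mat2 \<Rightarrow> real) \<Rightarrow> 'n cidx \<Rightarrow> 'n mat2 \<Rightarrow> real" where
  "multiplier G c M =
     det ((\<chi> p q. grad (if q = c then G else F q) M \<bullet> grad (F p) M) :: 'n cidx sqmat)
     / det ((\<chi> p q. grad (F q) M \<bullet> grad (F p) M) :: 'n cidx sqmat)"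

definition Sigma_AC :: "(('n::{finite,linorder}) mat2 \<Rightarrow> real) \<Rightarrow> 'n mat2 \<Rightarrow> 'n sqmat" where
  "Sigma_AC G M = (\<chi> i j.
     if i < j then multiplier G (Abs_cidx (AC i j)) M
     else if j < i then - multiplier G (Abs_cidx (AC j i)) M
     else 0)"

definition Sigma_BD :: "(('n::{finite,linorder}) mat2 \<Rightarrow> real) \<Rightarrow> 'n mat2 \<Rightarrow> 'n sqmat" where
  "Sigma_BD G M = (\<chi> i j.
     if i < j then multiplier G (Abs_cidx (BD i j)) M
     else if j < i then - multiplier G (Abs_cidx (BD j i)) M
     else 0)"

definition Sigma_AD :: "(('n::{finite,linorder}) mat2 \<Rightarrow> real) \<Rightarrow> 'n mat2 \<Rightarrow> 'n sqmat" where
  "Sigma_AD G M = (\<chi> i j. multiplier G (Abs_cidx (AD i j)) M)"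

definition Sigma_tilde :: "(('n::{finite,linorder}) mat2 \<Rightarrow> real) \<Rightarrow> 'n mat2 \<Rightarrow> 'n mat2" where
  "Sigma_tilde G M =
     block (Sigma_AC G M) (Sigma_AD G M) (- transpose (Sigma_AD G M)) (Sigma_BD G M)"

end

theory Submission
  imports Defs
begin

text \<open>Half the inner product of \<open>M\<^sup>TJM - J\<close> with a skew-symmetric \<open>S\<close> is a combination of the
  constraint functions with gradient \<open>-JMS\<close>, and every combination arises in this way.  Since \<open>M\<close> is symplectic, the
  gradient \<open>P\<close> of \<open>G\<close> is \<open>-JMS\<close> for exactly one matrix \<open>S\<close>, namely \<open>S = JM\<^sup>TP\<close>.  So \<open>P\<close> is normal
  to the symplectic group iff \<open>JM\<^sup>TP\<close> is skew-symmetric, and in that case the multipliers are the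
  entries of \<open>JM\<^sup>TP\<close> by Cramer's rule.  To get skew-symmetry from criticality it is enough to test
  the straight lines \<open>t \<mapsto> M(1 + t vv\<^sup>TJ)\<close> of transvections.\<close>

section \<open>Matrix algebra\<close>

lemma matrix_mul_uminus_left: "(- A) ** B = - (A ** B :: 'a::ring_1^'m^'k)"
  by (simp add: matrix_matrix_mult_def vec_eq_iff sum_negf)

lemma matrix_mul_uminus_right: "A ** (- B) = - (A ** B :: 'a::ring_1^'m^'k)"
  by (simp add: matrix_matrix_mult_def vec_eq_iff sum_negf)

lemma transpose_add: "transpose (A + B) = transpose A + (transpose B :: 'a::plus^'m^'k)"
  by (simp add: transpose_def vec_eq_iff)

lemma inner_transpose_transpose:
  "transpose A \<bullet> transpose B = (A :: real^'m::finite^'k::finite) \<bullet> B"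
  unfolding inner_vec_def transpose_def by simp (rule sum.swap)

lemma inner_matrix_mult_left:
  fixes A :: "real^'m::finite^'k::finite"
  shows "P \<bullet> (A ** B) = (transpose A ** P) \<bullet> B"
  by (simp add: inner_matrix_eq_trace matrix_transpose_mul matrix_mul_assoc)

lemma inner_matrix_mult_right:
  fixes A :: "real^'m::finite^'k::finite"
  shows "P \<bullet> (A ** B) = (P ** transpose B) \<bullet> A"
proof -
  have "P \<bullet> (A ** B) = transpose P \<bullet> (transpose B ** transpose A)"
    by (metis inner_transpose_transpose matrix_transpose_mul)
  also have "\<dots> = (B ** transpose P) \<bullet> transpose A"
    by (simp add: inner_matrix_mult_left)
  also have "\<dots> = (P ** transpose B) \<bullet> A"
    by (metis inner_transpose_transpose matrix_transpose_mul transpose_transpose)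
  finally show ?thesis .
qed

lemma inner_skew_symmetric_eq_0:
  fixes S :: "real^'m::finite^'m"
  assumes "transpose S = - S" "transpose Y = Y"
  shows "S \<bullet> Y = 0"
  using inner_transpose_transpose[of S Y] assms by simp

lemma bounded_bilinear_matrix_mult:
  "bounded_bilinear ((**) :: real^'m::finite^'k::finite \<Rightarrow> real^'l::finite^'m \<Rightarrow> real^'l^'k)"
  by (subst bilinear_conv_bounded_bilinear[symmetric])
    (auto simp: bilinear_def linear_iff matrix_matrix_mult_def vec_eq_iff algebra_simps
      sum.distrib sum_distrib_left)

lemma bounded_linear_transpose:
  "bounded_linear (transpose :: real^'m::finite^'k::finite \<Rightarrow> real^'k^'m)"
  by (subst linear_conv_bounded_linear[symmetric])
    (auto simp: linear_iff transpose_def vec_eq_iff)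

section \<open>Rank-one symmetric matrices and quadratic forms\<close>

definition outer :: "real^'m \<Rightarrow> real^'m^'m" where
  "outer v = (\<chi> i j. v $ i * v $ j)"

lemma transpose_outer: "transpose (outer v) = outer v"
  by (simp add: outer_def transpose_def vec_eq_iff mult.commute)

lemma inner_outer: "Q \<bullet> outer v = v \<bullet> (Q *v v)" for v :: "real^'m::finite"
  by (simp add: outer_def inner_vec_def matrix_vector_mult_def sum_distrib_left algebra_simps)

text \<open>In \<open>v (v\<^sup>T A v) v\<^sup>T\<close> the bracket is a scalar. It vanishes for
  skew \<open>A\<close>, which removes the quadratic term along a transvection line.\<close>

lemma outer_mult_outer:
  "outer v ** A ** outer v = (v \<bullet> (A *v v)) *\<^sub>R outer v" for v :: "real^'m::finite"
proof -
  have "(\<Sum>k\<in>UNIV. (\<Sum>l\<in>UNIV. v $ i * v $ l * A $ l $ k) * (v $ k * v $ j)) =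
      (\<Sum>l\<in>UNIV. v $ l * (\<Sum>k\<in>UNIV. A $ l $ k * v $ k)) * (v $ i * v $ j)" for i j
    unfolding sum_distrib_left sum_distrib_right
    by (subst sum.swap) (intro sum.cong refl, simp add: algebra_simps)
  then show ?thesis
    by (simp add: outer_def inner_vec_def matrix_vector_mult_def matrix_matrix_mult_def vec_eq_iff)
qed

text \<open>Polarization on pairs of basis vectors. It lets criticality be tested on rank-one
  directions only.\<close>

lemma skew_symmetric_if_quadratic_form_0:
  fixes Q :: "real^'m::finite^'m"
  assumes "\<And>v. v \<bullet> (Q *v v) = 0"
  shows "transpose Q = - Q"
proof -
  have entry: "axis i 1 \<bullet> (Q *v axis j 1) = Q $ i $ j" for i j
    by (simp add: inner_axis' matrix_vector_mult_basis column_def)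
  have "Q $ i $ j + Q $ j $ i = 0" for i j
    using assms[of "axis i 1 + axis j 1"] assms[of "axis i 1"] assms[of "axis j 1"]
    by (simp add: matrix_vector_right_distrib inner_add_left inner_add_right entry)
  then show ?thesis
    by (simp add: transpose_def vec_eq_iff eq_neg_iff_add_eq_0)
qed

lemma skew_symmetric_quadratic_form:
  fixes Q :: "real^'m::finite^'m"
  assumes "transpose Q = - Q"
  shows "v \<bullet> (Q *v v) = 0"
  using inner_skew_symmetric_eq_0[OF assms transpose_outer] by (simp add: inner_outer)

section \<open>Gradients and smooth curves\<close>

lemma grad_eqI:
  assumes "(f has_derivative (\<lambda>h. D \<bullet> h)) (at x)"
  shows "grad f x = D"
proof -
  have *: "GDERIV f x :> D"
    using assms by (simp add: gderiv_def inner_commute)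
  have "E = D" if "GDERIV f x :> E" for E
  proof -
    have "(\<lambda>h. h \<bullet> E) = (\<lambda>h. h \<bullet> D)"
      using that * unfolding gderiv_def by (rule has_derivative_unique)
    then show ?thesis
      by (metis vector_eq_ldot)
  qed
  with * show ?thesis
    unfolding grad_def by (intro the_equality)
qed

lemma has_derivative_grad:
  fixes f :: "'a::euclidean_space \<Rightarrow> real"
  assumes "f differentiable (at x)"
  shows "(f has_derivative (\<lambda>h. grad f x \<bullet> h)) (at x)"
proof -
  from assms obtain f' where f': "(f has_derivative f') (at x)"
    by (auto simp: differentiable_def)
  \<comment> \<open>Riesz representation: the vector representing the functional \<open>f'\<close>
    is its adjoint applied to 1.\<close>
  define D where "D = adjoint f' 1"
  have "f' = (\<lambda>h. D \<bullet> h)"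
    using adjoint_works[OF has_derivative_linear[OF f'], of _ 1]
    by (simp add: fun_eq_iff D_def inner_commute)
  with f' have "(f has_derivative (\<lambda>h. D \<bullet> h)) (at x)"
    by simp
  with grad_eqI[OF this] show ?thesis
    by simp
qed

lemma smooth_on_imp_differentiable:
  "smooth_on U f \<Longrightarrow> x \<in> U \<Longrightarrow> f differentiable (at x)"
  using Ck_on.simps(2)[of 0 U f] unfolding smooth_on_def by blast

lemma smooth_on_const: "smooth_on U (\<lambda>x. c)"
proof -
  have "Ck_on k U (\<lambda>x. c)" for k
    by (induction k arbitrary: c) simp_all
  then show ?thesis
    by (simp add: smooth_on_def)
qed

lemma smooth_on_line: "smooth_on U (\<lambda>t::real. a + t *\<^sub>R b)"
proof -
  have der: "((\<lambda>t::real. a + t *\<^sub>R b) has_derivative (\<lambda>h. h *\<^sub>R b)) (at t)" for t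
    by (auto intro!: derivative_eq_intros)
  have fd: "frechet_derivative (\<lambda>t::real. a + t *\<^sub>R b) (at t) = (\<lambda>h. h *\<^sub>R b)" for t
    using frechet_derivative_at[OF der] by simp
  have "Ck_on k U (\<lambda>t::real. a + t *\<^sub>R b)" for k
  proof (cases k)
    case 0
    then show ?thesis by (auto intro!: continuous_intros)
  next
    case (Suc m)
    with smooth_on_const[of U] der show ?thesis
      by (auto simp: smooth_on_def differentiable_def fd)
  qed
  then show ?thesis
    by (simp add: smooth_on_def)
qed

section \<open>Critical points on the symplectic group\<close>

lemma transpose_J: "transpose J = - J"
  by (auto simp: J_def block_def transpose_def vec_eq_iff mat_def split: sum.splits)

lemma UNIV_sum_eq: "sum f (UNIV :: ('a::finite + 'b::finite) set) =
    (\<Sum>i\<in>UNIV. f (Inl i)) + (\<Sum>i\<in>UNIV. f (Inr i))"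
  by (simp add: UNIV_Plus_UNIV[symmetric] sum.Plus del: UNIV_Plus_UNIV)

lemma J_mult_component:
  "(J ** X) $ Inl i = X $ Inr i" "(J ** X) $ Inr i = - X $ Inl i"
  by (simp_all add: J_def block_def matrix_matrix_mult_def vec_eq_iff UNIV_sum_eq mat_def
      if_distrib[of "\<lambda>x. x * _"] if_distrib[of uminus] cong: if_cong)

lemma J_mult_J: "J ** J = - mat 1"
  unfolding vec_eq_iff
proof (intro allI)
  fix r c :: "'n::finite + 'n"
  show "(J ** J) $ r $ c = (- mat 1 :: 'n mat2) $ r $ c"
    by (cases r; cases c; simp add: J_mult_component) (simp_all add: J_def block_def mat_def)
qed

lemma J_mult_J_mult: "J ** (J ** X) = - X"
  by (simp add: matrix_mul_assoc J_mult_J matrix_mul_uminus_left)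

text \<open>Multiplying \<open>M\<^sup>TJM = J\<close> by \<open>J\<close> shows that
  \<open>-JM\<^sup>TJ\<close> is a left inverse of \<open>M\<close>; for square matrices it is also
  a right inverse.\<close>

lemma Sp_inverse:
  assumes "M \<in> Sp"
  shows "M ** (J ** transpose M ** J) = - mat 1"
proof -
  have "J ** (transpose M ** J ** M) = - mat 1"
    using assms by (simp add: Sp_def J_mult_J)
  then have "(- (J ** transpose M ** J)) ** M = mat 1"
    by (simp add: matrix_mul_assoc matrix_mul_uminus_left)
  then have "M ** (- (J ** transpose M ** J)) = mat 1"
    by (simp add: matrix_left_right_inverse)
  then show ?thesis
    by (metis matrix_mul_uminus_right minus_minus)
qed

text \<open>Existence half of the representation \<open>P = -JMS\<close>. Inserting
  \<open>JJ = -1\<close> before \<open>P\<close> exposes the product from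
  \<open>Sp_inverse\<close>.\<close>

lemma Sp_normal_form:
  assumes "M \<in> Sp"
  shows "P = - (J ** M ** (J ** transpose M ** P))"
proof -
  have "J ** M ** (J ** transpose M ** P) = - (J ** (M ** (J ** transpose M ** J)) ** (J ** P))"
    by (simp add: matrix_mul_assoc[symmetric] J_mult_J_mult matrix_mul_uminus_right)
  also have "\<dots> = J ** (J ** P)"
    by (simp add: Sp_inverse[OF assms] matrix_mul_uminus_left matrix_mul_uminus_right)
  finally show ?thesis
    by (simp add: J_mult_J_mult)
qed

text \<open>Uniqueness half: \<open>S\<close> is recovered from \<open>-JMS\<close>, so this map is
  injective in \<open>S\<close>.\<close>

lemma Sp_normal_form_inverse:
  assumes "M \<in> Sp"
  shows "J ** transpose M ** (- (J ** M ** S)) = S"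
proof -
  have "J ** transpose M ** (- (J ** M ** S)) = - (J ** (transpose M ** J ** M) ** S)"
    by (simp add: matrix_mul_uminus_right matrix_mul_assoc)
  also have "\<dots> = S"
    using assms by (simp add: Sp_def J_mult_J matrix_mul_uminus_left)
  finally show ?thesis .
qed

text \<open>With \<open>N = 1 + tWJ\<close> and \<open>W = vv\<^sup>T\<close>, the linear terms of
  \<open>N\<^sup>TJN\<close> cancel and the quadratic one contains \<open>WJW = 0\<close>. So the
  whole straight line stays symplectic.\<close>

lemma transvection_line_in_Sp:
  assumes "M \<in> Sp"
  shows "M + t *\<^sub>R (M ** outer v ** J) \<in> Sp"
proof -
  define W where "W = outer v"
  define N where "N = mat 1 + t *\<^sub>R (W ** J)"
  have WJW: "W ** J ** W = 0"
    unfolding W_def outer_mult_outer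
    by (simp add: skew_symmetric_quadratic_form transpose_J)
  have MN: "M + t *\<^sub>R (M ** outer v ** J) = M ** N"
    unfolding N_def W_def
    by (simp add: matrix_add_ldistrib matrix_scalar_ac scalar_matrix_assoc matrix_mul_assoc)
  have "transpose N = mat 1 - t *\<^sub>R (J ** W)"
    by (simp add: N_def W_def transpose_add transpose_scalar matrix_transpose_mul transpose_outer
        transpose_J matrix_mul_uminus_left)
  moreover have "(mat 1 - t *\<^sub>R (J ** W)) ** J ** N =
      J - t *\<^sub>R t *\<^sub>R (J ** (W ** J ** W) ** J)"
    unfolding N_def
    by (simp add: bounded_bilinear.diff_left[OF bounded_bilinear_matrix_mult]
        bounded_bilinear.add_right[OF bounded_bilinear_matrix_mult]
        bounded_bilinear.scaleR_left[OF bounded_bilinear_matrix_mult]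
        bounded_bilinear.scaleR_right[OF bounded_bilinear_matrix_mult]
        matrix_mul_assoc algebra_simps)
  ultimately have "transpose N ** J ** N = J"
    by (simp add: WJW)
  moreover have "transpose (M ** N) ** J ** (M ** N) =
      transpose N ** (transpose M ** J ** M) ** N"
    by (simp add: matrix_transpose_mul matrix_mul_assoc)
  ultimately show ?thesis
    using assms by (simp add: MN Sp_def)
qed

lemma has_derivative_symplectic_form:
  fixes c :: "'a::real_normed_vector \<Rightarrow> ('n::finite) mat2"
  assumes "(c has_derivative c') (at x within U)"
  shows "((\<lambda>x. transpose (c x) ** J ** c x) has_derivative
    (\<lambda>h. transpose (c x) ** J ** c' h + transpose (c' h) ** J ** c x)) (at x within U)"
  by (intro bounded_bilinear.FDERIV[OF bounded_bilinear_matrix_mult]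
      bounded_linear.has_derivative[OF bounded_bilinear.bounded_linear_left
        [OF bounded_bilinear_matrix_mult]]
      bounded_linear.has_derivative[OF bounded_linear_transpose] assms)

text \<open>The condition on the right holds for the gradient \<open>P\<close> exactly if \<open>P\<close> is orthogonal to the
  tangent space of \<open>Sp\<close> at \<open>M\<close>.\<close>

lemma critical_point_on_Sp_iff:
  assumes der: "(G has_derivative (\<lambda>h. P \<bullet> h)) (at M)"
    and eq: "\<And>X. X \<in> Sp \<Longrightarrow> G X = Gt X"
    and M: "M \<in> Sp"
  shows "critical_point_on Sp Gt M \<longleftrightarrow>
    transpose (J ** transpose M ** P) = - (J ** transpose M ** P)"
proof
  assume crit: "critical_point_on Sp Gt M"
  have "v \<bullet> ((transpose M ** P ** J) *v v) = 0" for v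
  proof -
    define c where "c = (\<lambda>t::real. M + t *\<^sub>R (M ** outer v ** J))"
    have "smooth_on {-1<..<1} c" "c ` {-1<..<1} \<subseteq> Sp" "c 0 = M"
      using transvection_line_in_Sp[OF M] by (auto simp: c_def smooth_on_line)
    with crit have "((Gt \<circ> c) has_real_derivative 0) (at 0)"
      unfolding critical_point_on_def by (metis zero_less_one)
    moreover have "Gt \<circ> c = G \<circ> c"
      using transvection_line_in_Sp[OF M] eq by (auto simp: c_def)
    ultimately have 0: "((G \<circ> c) has_derivative (\<lambda>h. 0)) (at 0)"
      by (simp add: has_field_derivative_def lambda_zero)
    have c': "(c has_derivative (\<lambda>h. h *\<^sub>R (M ** outer v ** J))) (at 0)"
      unfolding c_def by (auto intro!: derivative_eq_intros)
    have "((G \<circ> c) has_derivative (\<lambda>h. P \<bullet> h) \<circ> (\<lambda>h. h *\<^sub>R (M ** outer v ** J))) (at 0)"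
      using diff_chain_at[OF c'] der \<open>c 0 = M\<close> by simp
    with 0 have "(\<lambda>h::real. 0) = (\<lambda>h. P \<bullet> h) \<circ> (\<lambda>h. h *\<^sub>R (M ** outer v ** J))"
      by (rule has_derivative_unique)
    from fun_cong[OF this, of 1] have "P \<bullet> (M ** outer v ** J) = 0"
      by simp
    \<comment> \<open>Moving \<open>M\<close> and \<open>J\<close> across the inner product by
      adjoints gives, up to sign, the quadratic form of \<open>M\<^sup>TPJ\<close> at
      \<open>v\<close>.\<close>
    then have "(transpose M ** P ** J) \<bullet> outer v = 0"
      by (simp only: inner_matrix_mult_right[of P _ J] inner_matrix_mult_left[of _ M])
        (simp add: transpose_J matrix_mul_uminus_right matrix_mul_assoc)
    then show ?thesis
      by (simp add: inner_outer)
  qed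
  then have *: "transpose (transpose M ** P ** J) = - (transpose M ** P ** J)"
    by (rule skew_symmetric_if_quadratic_form_0)
  \<comment> \<open>Multiplying by \<open>J\<close> on both sides carries the skew-symmetry of
    \<open>M\<^sup>TPJ\<close> over to \<open>JM\<^sup>TP\<close>.\<close>
  have "J ** transpose (transpose M ** P ** J) ** J = transpose P ** M ** J"
    by (simp add: matrix_transpose_mul transpose_J matrix_mul_assoc J_mult_J matrix_mul_uminus_left
      matrix_mul_uminus_right)
  moreover have "J ** (- (transpose M ** P ** J)) ** J = J ** transpose M ** P"
    by (simp add: matrix_mul_assoc[symmetric] J_mult_J matrix_mul_uminus_left
      matrix_mul_uminus_right)
  ultimately have "transpose P ** M ** J = J ** transpose M ** P"
    using * by metis
  then show "transpose (J ** transpose M ** P) = - (J ** transpose M ** P)"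
    by (simp add: matrix_transpose_mul transpose_J matrix_mul_assoc matrix_mul_uminus_right)
next
  define S where "S = J ** transpose M ** P"
  assume skew: "transpose (J ** transpose M ** P) = - (J ** transpose M ** P)"
  have "((Gt \<circ> c) has_real_derivative 0) (at 0)"
    if e: "e > 0" and sm: "smooth_on {-e<..<e} c" and c: "c ` {-e<..<e} \<subseteq> Sp" "c 0 = M"
    for c e
  proof -
    have "c differentiable (at 0)"
      using smooth_on_imp_differentiable[OF sm, of 0] e by simp
    then obtain c' where c': "(c has_derivative c') (at 0)"
      by (auto simp: differentiable_def)
    have ev: "\<forall>\<^sub>F t in at 0. c t \<in> Sp"
      using e c(1) by (intro eventually_at_in_open'[THEN eventually_mono, of "{-e<..<e}"]) auto
    \<comment> \<open>The form is constantly \<open>J\<close> along the curve near 0; comparison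
      with the product rule yields the tangent space equation.\<close>
    have "((\<lambda>t. transpose (c t) ** J ** c t) has_derivative (\<lambda>h. 0)) (at 0)"
      by (rule has_derivative_transform_eventually[OF has_derivative_const[of J]])
        (use ev M c in \<open>auto simp: Sp_def elim: eventually_mono\<close>)
    then have "(\<lambda>h. transpose (c 0) ** J ** c' h + transpose (c' h) ** J ** c 0) = (\<lambda>h. 0)"
      by (rule has_derivative_unique[OF has_derivative_symplectic_form[OF c']])
    then have tangent: "transpose M ** J ** c' h + transpose (c' h) ** J ** M = 0" for h
      using c(2) by metis
    have "P \<bullet> c' h = 0" for h
    proof -
      \<comment> \<open>Tangency means that \<open>M\<^sup>TJ(c' h)\<close> is symmetric, hence
        orthogonal to the skew matrix \<open>S\<close>.\<close>
      have "transpose (transpose M ** J ** c' h) = transpose M ** J ** c' h"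
        using tangent[of h]
        by (simp add: matrix_transpose_mul transpose_J matrix_mul_uminus_left
            matrix_mul_uminus_right matrix_mul_assoc eq_neg_iff_add_eq_0 neg_eq_iff_add_eq_0
            add.commute)
      with skew have "S \<bullet> (transpose M ** J ** c' h) = 0"
        unfolding S_def by (rule inner_skew_symmetric_eq_0)
      then have "(J ** M ** S) \<bullet> c' h = 0"
        by (simp add: inner_matrix_mult_left matrix_transpose_mul transpose_J
            matrix_mul_uminus_left)
      then show ?thesis
        by (subst Sp_normal_form[OF M]) (simp add: S_def)
    qed
    then have "((G \<circ> c) has_derivative (\<lambda>h. 0)) (at 0)"
      using diff_chain_at[OF c', of G "\<lambda>h. P \<bullet> h"] der c(2) by (simp add: o_def)
    then have "((Gt \<circ> c) has_derivative (\<lambda>h. 0)) (at 0)"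
      by (rule has_derivative_transform_eventually)
        (use ev M c eq in \<open>auto elim: eventually_mono\<close>)
    then show ?thesis
      by (simp add: has_field_derivative_def lambda_zero)
  qed
  with M show "critical_point_on Sp Gt M"
    unfolding critical_point_on_def by blast
qed

section \<open>Constraint gradients and multipliers\<close>

text \<open>The constraint \<open>F c\<close> is the entry of \<open>M\<^sup>TJM - J\<close> in row \<open>lrow c\<close> and column \<open>lcol c\<close>.\<close>

fun label_row :: "'n label \<Rightarrow> 'n + 'n" where
  "label_row (AC i j) = Inl i" | "label_row (BD i j) = Inr i" | "label_row (AD i j) = Inl i"

fun label_col :: "'n label \<Rightarrow> 'n + 'n" where
  "label_col (AC i j) = Inl j" | "label_col (BD i j) = Inr j" | "label_col (AD i j) = Inr j"

abbreviation lrow :: "('n::{finite,linorder}) cidx \<Rightarrow> 'n + 'n" where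
  "lrow c \<equiv> label_row (Rep_cidx c)"

abbreviation lcol :: "('n::{finite,linorder}) cidx \<Rightarrow> 'n + 'n" where
  "lcol c \<equiv> label_col (Rep_cidx c)"

text \<open>The positions of the constraints are exactly those strictly above the diagonal, with the
  \<open>Inl\<close> indices before the \<open>Inr\<close> ones. So these matrices form the standard
  basis of the skew-symmetric matrices.\<close>

definition skew_unit :: "('n::{finite,linorder}) cidx \<Rightarrow> 'n mat2" where
  "skew_unit c = (\<chi> r s. (if r = lrow c \<and> s = lcol c then 1 else 0)
                       - (if r = lcol c \<and> s = lrow c then 1 else 0))"

lemma transpose_skew_unit: "transpose (skew_unit c) = - skew_unit c"
  by (simp add: skew_unit_def transpose_def vec_eq_iff conj_commute)

lemma inner_skew_unit: "skew_unit c \<bullet> Y = Y $ lrow c $ lcol c - Y $ lcol c $ lrow c"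
proof -
  have "(\<Sum>i\<in>UNIV. \<Sum>j\<in>UNIV. (if i = a \<and> j = b then 1 else 0) * Y $ i $ j) = Y $ a $ b" for a b
  proof -
    have "(\<Sum>j\<in>UNIV. (if i = a \<and> j = b then 1 else 0) * Y $ i $ j) = (if i = a then Y $ i $ b else 0)"
      for i
      by (simp add: if_distrib[of "\<lambda>x. x * _"] cong: if_cong)
    then show ?thesis by simp
  qed
  then show ?thesis
    by (simp add: skew_unit_def inner_vec_def left_diff_distrib sum_subtractf)
qed

text \<open>Distinct labels have distinct positions, and no position is the mirror image of one:
  \<open>AC\<close> and \<open>BD\<close> require \<open>i < j\<close>, and \<open>AD\<close> always
  goes from \<open>Inl\<close> to \<open>Inr\<close>.\<close>

lemma skew_unit_component: "skew_unit q $ lrow p $ lcol p = (if p = q then 1 else 0)"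
proof -
  have "label_row l = label_row m \<and> label_col l = label_col m \<longleftrightarrow> l = m"
    "\<not> (label_row l = label_col m \<and> label_col l = label_row m)"
    if "l \<in> labels" "m \<in> labels" for l m :: "'n::{finite,linorder} label"
    using that by (cases l; cases m; auto simp: labels_def)+
  from this[OF Rep_cidx[of p] Rep_cidx[of q]] show ?thesis
    by (simp add: skew_unit_def Rep_cidx_inject)
qed

lemma skew_eqI:
  fixes S T :: "('n::{finite,linorder}) mat2"
  assumes "transpose S = - S" "transpose T = - T"
    and entry: "\<And>c. S $ lrow c $ lcol c = T $ lrow c $ lcol c"
  shows "S = T"
proof -
  have skew: "S $ s $ r = - S $ r $ s" "T $ s $ r = - T $ r $ s" for r s
    using arg_cong[OF assms(1), of "\<lambda>X. X $ r $ s"] arg_cong[OF assms(2), of "\<lambda>X. X $ r $ s"]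
    by (simp_all add: transpose_def)
  have upper: "S $ label_row l $ label_col l = T $ label_row l $ label_col l" if "l \<in> labels" for l
    using entry[of "Abs_cidx l"] that by (simp add: Abs_cidx_inverse)
  have rows: "S $ Inl i $ Inr j = T $ Inl i $ Inr j" for i j
    using upper[of "AD i j"] by (simp add: labels_def)
  have "S $ Inl i $ Inl j = T $ Inl i $ Inl j \<and> S $ Inr i $ Inr j = T $ Inr i $ Inr j" for i j
    using upper[of "AC i j"] upper[of "AC j i"] upper[of "BD i j"] upper[of "BD j i"]
      skew[of "Inl i" "Inl j"] skew[of "Inr i" "Inr j"]
    \<comment> \<open>For \<open>i = j\<close> skew-symmetry forces both entries to be 0; for
      \<open>j < i\<close> it reduces to the swapped indices.\<close>
    by (cases i j rule: linorder_cases) (auto simp: labels_def)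
  then have "S $ r $ s = T $ r $ s" for r s
    using rows skew[of "Inl _" "Inr _"] by (cases r; cases s) auto
  then show ?thesis
    by (simp add: vec_eq_iff)
qed

lemma sum_skew_unit:
  fixes x :: "('n::{finite,linorder}) cidx \<Rightarrow> real"
  shows "transpose (\<Sum>q\<in>UNIV. x q *\<^sub>R skew_unit q) = - (\<Sum>q\<in>UNIV. x q *\<^sub>R skew_unit q)"
    and "(\<Sum>q\<in>UNIV. x q *\<^sub>R skew_unit q) $ lrow p $ lcol p = x p"
proof -
  show "transpose (\<Sum>q\<in>UNIV. x q *\<^sub>R skew_unit q) = - (\<Sum>q\<in>UNIV. x q *\<^sub>R skew_unit q)"
    by (simp add: bounded_linear.linear[OF bounded_linear_transpose] linear_sum linear_cmul
        transpose_skew_unit sum_negf)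
  show "(\<Sum>q\<in>UNIV. x q *\<^sub>R skew_unit q) $ lrow p $ lcol p = x p"
    by (simp add: sum_component skew_unit_component if_distrib[of "\<lambda>y. _ * y"] cong: if_cong)
qed

lemma F_eq_entry: "F c X = (transpose X ** J ** X - J) $ lrow c $ lcol c"
proof -
  have *: "(transpose X ** J ** X) $ r $ s =
      (\<Sum>k\<in>UNIV. X $ Inl k $ r * X $ Inr k $ s) - (\<Sum>k\<in>UNIV. X $ Inr k $ r * X $ Inl k $ s)" for r s
  proof -
    have "(transpose X ** J ** X) $ r $ s = (\<Sum>k\<in>UNIV. X $ k $ r * (J ** X) $ k $ s)"
      by (simp add: matrix_mul_assoc[symmetric]) (simp add: matrix_matrix_mult_def transpose_def)
    then show ?thesis
      by (simp add: UNIV_sum_eq J_mult_component sum_negf)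
  qed
  show ?thesis
    unfolding F_def
    \<comment> \<open>The entry of \<open>J\<close> supplies the Kronecker delta for
      \<open>AD\<close> and is 0 for \<open>AC\<close> and \<open>BD\<close>.\<close>
    by (cases "Rep_cidx c"; simp add: *)
      (simp_all add: colA_def colB_def colC_def colD_def inner_vec_def J_def block_def mat_def
        mult.commute)
qed

lemma grad_F: "grad (F c) M = - (J ** M ** skew_unit c)"
proof (rule grad_eqI)
  have "((\<lambda>X. (transpose X ** J ** X) $ lrow c $ lcol c - J $ lrow c $ lcol c) has_derivative
      (\<lambda>h. (transpose M ** J ** h + transpose h ** J ** M) $ lrow c $ lcol c - 0)) (at M)"
    by (intro has_derivative_diff has_derivative_const
        bounded_linear.has_derivative[OF bounded_linear_vec_nth]
        has_derivative_symplectic_form has_derivative_ident)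
  moreover have "(transpose M ** J ** h + transpose h ** J ** M) $ lrow c $ lcol c =
      (- (J ** M ** skew_unit c)) \<bullet> h" for h
  proof -
    \<comment> \<open>The derivative is thus a matrix minus its transpose, and its entry is an inner
      product with \<open>skew_unit c\<close>.\<close>
    have "transpose h ** J ** M = - transpose (transpose M ** J ** h)"
      by (simp add: matrix_transpose_mul transpose_J matrix_mul_uminus_left
          matrix_mul_uminus_right matrix_mul_assoc)
    then have "(transpose M ** J ** h + transpose h ** J ** M) $ lrow c $ lcol c =
        skew_unit c \<bullet> (transpose M ** J ** h)"
      by (simp add: inner_skew_unit transpose_def)
    then show ?thesis
      by (simp add: inner_matrix_mult_left matrix_transpose_mul transpose_J
          matrix_mul_uminus_left)
  qed
  ultimately show "(F c has_derivative (\<lambda>h. (- (J ** M ** skew_unit c)) \<bullet> h)) (at M)"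
    by (simp add: F_eq_entry[abs_def])
qed

lemma sum_grad_F:
  "(\<Sum>q\<in>UNIV. x q *\<^sub>R grad (F q) M) = - (J ** M ** (\<Sum>q\<in>UNIV. x q *\<^sub>R skew_unit q))"
  by (simp add: grad_F bounded_bilinear.sum_right[OF bounded_bilinear_matrix_mult]
      bounded_bilinear.scaleR_right[OF bounded_bilinear_matrix_mult] sum_negf)

section \<open>The Gram matrix of the constraint gradients and Cramer's rule\<close>

definition gram :: "('n::{finite,linorder}) mat2 \<Rightarrow> 'n cidx sqmat" where
  "gram M = (\<chi> p q. grad (F q) M \<bullet> grad (F p) M)"

lemma gram_mult_component: "(gram M *v x) $ p = (\<Sum>q\<in>UNIV. x $ q *\<^sub>R grad (F q) M) \<bullet> grad (F p) M"
  by (simp add: gram_def matrix_vector_mult_def inner_sum_left mult.commute)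

text \<open>A kernel vector gives a combination of the gradients orthogonal to each of them, hence
  to itself, so it is 0. Injectivity of \<open>-JMS\<close> in \<open>S\<close> and independence of
  the skew units make its coefficients 0.\<close>

lemma det_gram_nonzero:
  fixes M :: "('n::{finite,linorder}) mat2"
  assumes "M \<in> Sp"
  shows "det (gram M) \<noteq> 0"
proof -
  have "x = 0" if "gram M *v x = 0" for x
  proof -
    define v where "v = (\<Sum>q\<in>UNIV. x $ q *\<^sub>R grad (F q) M)"
    have "v \<bullet> grad (F p) M = 0" for p
      using that gram_mult_component[of M x p] by (simp add: v_def)
    then have "v \<bullet> v = 0"
      by (subst (2) v_def) (simp add: inner_sum_right)
    then have "- (J ** M ** (\<Sum>q\<in>UNIV. x $ q *\<^sub>R skew_unit q)) = 0"
      by (simp add: v_def sum_grad_F)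
    then have "(\<Sum>q\<in>UNIV. x $ q *\<^sub>R skew_unit q) = 0"
      using Sp_normal_form_inverse[OF assms, of "\<Sum>q\<in>UNIV. x $ q *\<^sub>R skew_unit q"]
      by (simp add: bounded_bilinear.zero_right[OF bounded_bilinear_matrix_mult])
    then have "x $ p = 0" for p
      using sum_skew_unit(2)[of "($) x" p] by simp
    then show ?thesis
      by (simp add: vec_eq_iff)
  qed
  then show ?thesis
    by (metis invertible_det_nz invertible_left_inverse matrix_left_invertible_ker)
qed

text \<open>Expanding the skew matrix \<open>S\<close> in skew units writes \<open>grad G M\<close>
  as a combination of constraint gradients. Pairing with each of them gives a linear system with the
  Gram matrix, solved by Cramer's rule.\<close>

lemma multiplier_eq_entry:
  assumes M: "M \<in> Sp"
    and skew: "transpose (J ** transpose M ** grad G M) = - (J ** transpose M ** grad G M)"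
  shows "multiplier G c M = (J ** transpose M ** grad G M) $ lrow c $ lcol c"
proof -
  define S where "S = J ** transpose M ** grad G M"
  define x where "x = (\<chi> q. S $ lrow q $ lcol q)"
  have "S = (\<Sum>q\<in>UNIV. x $ q *\<^sub>R skew_unit q)"
  proof (rule skew_eqI)
    show "transpose S = - S"
      using skew unfolding S_def .
    show "S $ lrow p $ lcol p = (\<Sum>q\<in>UNIV. x $ q *\<^sub>R skew_unit q) $ lrow p $ lcol p" for p
      unfolding sum_skew_unit(2) by (simp add: x_def)
  qed (rule sum_skew_unit(1))
  then have grad_G: "grad G M = (\<Sum>q\<in>UNIV. x $ q *\<^sub>R grad (F q) M)"
    using Sp_normal_form[OF M, of "grad G M"] by (simp add: sum_grad_F S_def)
  have "(gram M *v x) $ p = grad G M \<bullet> grad (F p) M" for p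
    by (simp only: gram_mult_component grad_G[symmetric])
  then have "gram M *v x = (\<chi> p. grad G M \<bullet> grad (F p) M)"
    by (simp add: vec_eq_iff)
  then have "x = (\<chi> k. det (\<chi> p q. if q = k then grad G M \<bullet> grad (F p) M else gram M $ p $ q)
      / det (gram M))"
    by (simp only: cramer[OF det_gram_nonzero[OF M]] vec_lambda_beta)
  from arg_cong[OF this, of "\<lambda>x. x $ c"]
  have "x $ c = det (\<chi> p q. if q = c then grad G M \<bullet> grad (F p) M else gram M $ p $ q)
      / det (gram M)"
    by (simp only: vec_lambda_beta)
  \<comment> \<open>Replacing column \<open>c\<close> of the Gram matrix amounts to replacing
    \<open>F c\<close> by \<open>G\<close> in the numerator.\<close>
  also have "\<dots> = multiplier G c M"
    unfolding multiplier_def gram_def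
    by (intro arg_cong2[of _ _ _ _ "(/)"] arg_cong[of _ _ det]) (simp_all add: vec_eq_iff)
  finally show ?thesis
    by (simp add: x_def S_def)
qed

lemma transpose_Sigma_tilde: "transpose (Sigma_tilde G M) = - Sigma_tilde G M"
  by (auto simp: Sigma_tilde_def block_def Sigma_AC_def Sigma_BD_def Sigma_AD_def transpose_def
      vec_eq_iff split: sum.splits)

lemma Sigma_tilde_entry: "Sigma_tilde G M $ lrow c $ lcol c = multiplier G c M"
proof (cases c)
  case (Abs_cidx l)
  then show ?thesis
    by (cases l) (simp_all add: Abs_cidx_inverse Sigma_tilde_def block_def Sigma_AC_def
      Sigma_BD_def Sigma_AD_def, auto simp: labels_def)
qed

theorem theorem2p2:
  fixes Gt G :: "('n::{finite,linorder}) mat2 \<Rightarrow> real" and M :: "'n mat2"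
  assumes "smooth_on_submanifold Sp Gt"
    and "smooth_on UNIV G"
    and "\<And>X. X \<in> Sp \<Longrightarrow> G X = Gt X"
    and "M \<in> Sp"
  shows "(critical_point_on Sp Gt M \<longleftrightarrow>
            J ** transpose M ** grad G M = transpose (grad G M) ** M ** J) \<and>
         (critical_point_on Sp Gt M \<longrightarrow>
            Sigma_tilde G M = J ** transpose M ** grad G M)"
proof -
  define S where "S = J ** transpose M ** grad G M"
  have "transpose S = - (transpose (grad G M) ** M ** J)"
    by (simp add: S_def matrix_transpose_mul transpose_J matrix_mul_uminus_right matrix_mul_assoc)
  then have "transpose S = - S \<longleftrightarrow> S = transpose (grad G M) ** M ** J"
    by auto
  moreover have "critical_point_on Sp Gt M \<longleftrightarrow> transpose S = - S"
    unfolding S_def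
    by (intro critical_point_on_Sp_iff[where G = G] has_derivative_grad
        smooth_on_imp_differentiable[OF assms(2)] assms(3,4) UNIV_I)
  \<comment> \<open>Both matrices are skew-symmetric, so agreement above the diagonal suffices;
    there both have the multipliers as entries.\<close>
  moreover have "Sigma_tilde G M = S" if "transpose S = - S"
    by (rule skew_eqI)
      (use that in \<open>simp_all add: transpose_Sigma_tilde Sigma_tilde_entry S_def
        multiplier_eq_entry[OF assms(4)]\<close>)
  ultimately show ?thesis
    by (simp add: S_def)
qed

end
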